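(* Let $k$ be a positive integer. If a graph $G$ contains a $k$-trail, then $G$ is a $(k+1)$-trail.
   Context: All graphs are undirected, connected, may have loops and parallel edges, and have at least $2$ vertices. A graph $G=(V,E)$ is the homomorphic image of a graph $H=(W,F)$ by an onto function $\phi:W\rightarrow V$ if for any two vertices $u,v\in V$ (possibly $u=v$), the number of edges of $G$ between $u$ and $v$ equals the number of edges of $H$ whose endpoints are mapped by $\phi$ to $\{u,v\}$. $G$ is a $k$-trail if it is the homomorphic image of a connected graph of maximum degree at most $k$. A graph $G=(V,E)$ contains a $k$-trail if there is $U\subseteq E$ such that $(V,U)$ is a $k$-trail. *)

theory Defs
  imports Main "HOL-Library.Uprod"
begin

(* An edge carries an unordered pair of end points: edges with the same ends are parallel,
   and an edge with ends Upair v v is a loop at v. *)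
record ('v, 'e) multigraph =
  verts :: "'v set"
  edges :: "'e set"
  ends :: "'e \<Rightarrow> 'v uprod"

definition edges_between :: "('v, 'e) multigraph \<Rightarrow> 'v \<Rightarrow> 'v \<Rightarrow> 'e set" where
  "edges_between G u v = {e \<in> edges G. ends G e = Upair u v}"

definition adjacency :: "('v, 'e) multigraph \<Rightarrow> 'v rel" where
  "adjacency G = {(u, v). edges_between G u v \<noteq> {}}"

definition connected_graph :: "('v, 'e) multigraph \<Rightarrow> bool" where
  "connected_graph G \<longleftrightarrow> (\<forall>u\<in>verts G. \<forall>v\<in>verts G. (u, v) \<in> (adjacency G)\<^sup>*)"

(* The standing convention on graphs: finite, connected, at least two vertices. *)
definition is_graph :: "('v, 'e) multigraph \<Rightarrow> bool" where
  "is_graph G \<longleftrightarrow>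
     finite (verts G) \<and> finite (edges G) \<and> (\<forall>e\<in>edges G. set_uprod (ends G e) \<subseteq> verts G) \<and>
     connected_graph G \<and> card (verts G) \<ge> 2"

(* A loop contributes 2 to the degree of its vertex. *)
definition vertex_degree :: "('v, 'e) multigraph \<Rightarrow> 'v \<Rightarrow> nat" where
  "vertex_degree G v = card {e \<in> edges G. v \<in> set_uprod (ends G e)} + card (edges_between G v v)"

definition hom_image_by ::
    "('v, 'e) multigraph \<Rightarrow> ('w, 'f) multigraph \<Rightarrow> ('w \<Rightarrow> 'v) \<Rightarrow> bool" where
  "hom_image_by G H \<phi> \<longleftrightarrow>
     \<phi> ` verts H = verts G \<and>
     (\<forall>u\<in>verts G. \<forall>v\<in>verts G.
        card (edges_between G u v) = card {f \<in> edges H. map_uprod \<phi> (ends H f) = Upair u v})"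

(* The definition cannot quantify over the types of H; as H is finite, natural numbers suffice
   as its vertices and edges. Lemma k_trailI confirms that nothing is lost. *)
definition k_trail :: "nat \<Rightarrow> ('v, 'e) multigraph \<Rightarrow> bool" where
  "k_trail k G \<longleftrightarrow> is_graph G \<and>
     (\<exists>(H :: (nat, nat) multigraph) \<phi>.
        is_graph H \<and> (\<forall>w\<in>verts H. vertex_degree H w \<le> k) \<and> hom_image_by G H \<phi>)"

definition contains_k_trail :: "nat \<Rightarrow> ('v, 'e) multigraph \<Rightarrow> bool" where
  "contains_k_trail k G \<longleftrightarrow> (\<exists>U \<subseteq> edges G. k_trail k (G\<lparr>edges := U\<rparr>))"

lemma k_trailI:
  fixes G :: "('v, 'e) multigraph" and H :: "('w, 'f) multigraph"
  assumes G: "is_graph G" and H: "is_graph H" and deg: "\<forall>w\<in>verts H. vertex_degree H w \<le> k"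
    and hom: "hom_image_by G H \<phi>"
  shows "k_trail k G"
proof -
  have fin: "finite (verts H)" "finite (edges H)"
    and ends_H: "\<And>e. e \<in> edges H \<Longrightarrow> set_uprod (ends H e) \<subseteq> verts H"
    using H by (auto simp: is_graph_def)
  obtain p :: "'w \<Rightarrow> nat" where p: "inj_on p (verts H)"
    using fin(1) finite_imp_inj_to_nat_seg by blast
  obtain q :: "'f \<Rightarrow> nat" where q: "inj_on q (edges H)"
    using fin(2) finite_imp_inj_to_nat_seg by blast
  define H' :: "(nat, nat) multigraph" where
    "H' = \<lparr>verts = p ` verts H, edges = q ` edges H,
           ends = (\<lambda>i. map_uprod p (ends H (inv_into (edges H) q i)))\<rparr>"
  define \<psi> where "\<psi> = \<phi> \<circ> inv_into (verts H) p"
  have V': "verts H' = p ` verts H" and E': "edges H' = q ` edges H"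
    by (simp_all add: H'_def)
  have e': "ends H' (q e) = map_uprod p (ends H e)" if "e \<in> edges H" for e
    using that q by (simp add: H'_def)
  have map_eq: "map_uprod p x = Upair (p u) (p v) \<longleftrightarrow> x = Upair u v"
    if "set_uprod x \<subseteq> verts H" "u \<in> verts H" "v \<in> verts H" for x u v
    using that p by (cases x) (auto simp: inj_on_eq_iff)
  have between: "edges_between H' (p u) (p v) = q ` edges_between H u v"
    if "u \<in> verts H" "v \<in> verts H" for u v
    using that map_eq ends_H by (auto simp: edges_between_def E' e')
  have card_q: "card (q ` A) = card A" if "A \<subseteq> edges H" for A
    using that q by (meson card_image inj_on_subset)
  have deg': "vertex_degree H' (p w) = vertex_degree H w" if "w \<in> verts H" for w
  proof -
    have iff: "p w \<in> set_uprod (ends H' (q e)) \<longleftrightarrow> w \<in> set_uprod (ends H e)" if "e \<in> edges H" for e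
      using p \<open>w \<in> verts H\<close> ends_H[OF that]
      by (auto simp: e'[OF that] uprod.set_map inj_on_image_mem_iff)
    have "{e \<in> edges H'. p w \<in> set_uprod (ends H' e)} = q ` {e \<in> edges H. w \<in> set_uprod (ends H e)}"
      using iff unfolding E' by blast
    moreover have "edges_between H w w \<subseteq> edges H"
      by (auto simp: edges_between_def)
    ultimately show ?thesis
      using that by (simp add: vertex_degree_def between card_q)
  qed
  have reach: "v \<in> verts H \<and> (p u, p v) \<in> (adjacency H')\<^sup>*"
    if "(u, v) \<in> (adjacency H)\<^sup>*" "u \<in> verts H" for u v
    using that(1)
  proof (induction rule: rtrancl_induct)
    case base
    then show ?case using that(2) by simp
  next
    case (step y z)
    then have z: "z \<in> verts H"
      using ends_H[THEN subsetD] by (fastforce simp: adjacency_def edges_between_def)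
    with step have "(p y, p z) \<in> adjacency H'"
      by (auto simp: adjacency_def between)
    with step z show ?case by (meson rtrancl.rtrancl_into_rtrancl)
  qed
  have "connected_graph H'"
    using H reach unfolding connected_graph_def is_graph_def V' by blast
  moreover have "card (verts H') = card (verts H)"
    using p by (simp add: V' card_image)
  moreover have "\<forall>e\<in>edges H'. set_uprod (ends H' e) \<subseteq> verts H'"
    using ends_H by (auto simp: E' V' e' uprod.set_map)
  ultimately have "is_graph H'"
    using H by (simp add: is_graph_def V' E')
  moreover have "\<forall>w\<in>verts H'. vertex_degree H' w \<le> k"
    using deg deg' by (auto simp: V')
  moreover have "hom_image_by G H' \<psi>"
  proof -
    have "\<psi> ` verts H' = verts G"
      using hom p by (auto simp: hom_image_by_def V' \<psi>_def image_image)
    moreover have "{f \<in> edges H'. map_uprod \<psi> (ends H' f) = Upair u v}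
        = q ` {f \<in> edges H. map_uprod \<phi> (ends H f) = Upair u v}" for u v
    proof -
      have "map_uprod \<psi> (map_uprod p (ends H e)) = map_uprod \<phi> (ends H e)" if "e \<in> edges H" for e
        using ends_H[OF that] p by (cases "ends H e") (simp add: \<psi>_def)
      then show ?thesis by (auto simp: E' e')
    qed
    ultimately show ?thesis
      using hom by (simp add: hom_image_by_def card_q)
  qed
  ultimately show ?thesis
    using G by (auto simp: k_trail_def)
qed

end

theory Submission
  imports Defs "HOL-Library.Multiset"
begin

text \<open>
  Let \<open>D\<close> be the multiset of edges of \<open>G\<close> outside the \<open>k\<close>-trail, and induct on its size. If every
  vertex has degree at most 1 in \<open>D\<close>, every edge of \<open>D\<close> can be attached to arbitrary copies of its
  ends, and every copy gains degree at most 1. Otherwise \<open>D\<close> has a loop at some \<open>v\<close> or two edges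
  \<open>av\<close>, \<open>vb\<close>. In the second case replace the two edges by one edge \<open>ab\<close>; once \<open>ab\<close> is realised,
  subdivide it by a new copy of \<open>v\<close>, of degree 2. A loop at \<open>v\<close> is added by subdividing, again by a
  copy of \<open>v\<close>, any edge at a copy of \<open>v\<close>.
\<close>

section \<open>Multisets of unordered pairs in place of graphs\<close>

definition edge_mset :: "('v, 'e) multigraph \<Rightarrow> 'v uprod multiset" where
  "edge_mset G = image_mset (ends G) (mset_set (edges G))"

definition mset_degree :: "'v uprod multiset \<Rightarrow> 'v \<Rightarrow> nat" where
  "mset_degree M v = size {#e \<in># M. v \<in> set_uprod e#} + count M (Upair v v)"

definition mset_connected :: "'v set \<Rightarrow> 'v uprod multiset \<Rightarrow> bool" where
  "mset_connected W F \<longleftrightarrow> (\<forall>u\<in>W. \<forall>v\<in>W. (u, v) \<in> {(a, b). Upair a b \<in># F}\<^sup>*)"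

text \<open>Edges lose their names and \<open>M\<close> need not come from \<open>G\<close>: the
  induction passes through multisets with a pair that \<open>G\<close> may lack. With natural
  numbers for \<open>W\<close>, a fresh copy is always available.\<close>

definition trail_image :: "nat \<Rightarrow> 'v set \<Rightarrow> 'v uprod multiset \<Rightarrow> bool" where
  "trail_image d V M \<longleftrightarrow> (\<exists>(W :: nat set) F \<phi>.
     finite W \<and> card W \<ge> 2 \<and> (\<forall>e\<in>#F. set_uprod e \<subseteq> W) \<and> mset_connected W F \<and>
     (\<forall>w\<in>W. mset_degree F w \<le> d) \<and> \<phi> ` W = V \<and> image_mset (map_uprod \<phi>) F = M)"

lemma mset_degree_empty [simp]: "mset_degree {#} v = 0"
  by (simp add: mset_degree_def)

lemma mset_degree_plus [simp]: "mset_degree (A + B) v = mset_degree A v + mset_degree B v"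
  by (simp add: mset_degree_def)

text \<open>Counting the two ends separately gives a loop its weight 2 without a case
  distinction.\<close>

lemma mset_degree_add_mset [simp]:
  "mset_degree (add_mset (Upair a b) M) v = of_bool (v = a) + of_bool (v = b) + mset_degree M v"
  by (auto simp: mset_degree_def)

text \<open>Every end at \<open>w\<close> becomes an end at \<open>\<phi> w\<close>; other copies of
  \<open>\<phi> w\<close> can only add more.\<close>

lemma mset_degree_le_image:
  "mset_degree F w \<le> mset_degree (image_mset (map_uprod \<phi>) F) (\<phi> w)"
proof (induction F)
  case (add e F)
  then show ?case by (cases e) (auto simp: of_bool_def)
qed simp

lemma mset_degree_pos:
  assumes "mset_degree M v > 0"
  obtains a M' where "M = add_mset (Upair v a) M'"
proof -
  have "\<exists>e. e \<in># M \<and> v \<in> set_uprod e"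
  proof (rule ccontr)
    assume no: "\<not> ?thesis"
    then have "{#e \<in># M. v \<in> set_uprod e#} = {#}" by auto
    moreover have "count M (Upair v v) = 0"
      using no by (auto simp: not_in_iff[symmetric])
    ultimately show False using assms by (simp only: mset_degree_def size_empty)
  qed
  then obtain e where e: "e \<in># M" "v \<in> set_uprod e" by blast
  then obtain a where "e = Upair v a"
    by (cases e) (auto simp: Upair_inject)
  with e show thesis by (metis that multi_member_split)
qed

section \<open>Translation between graphs and edge multisets\<close>

lemma edge_mset_degree:
  assumes "finite (edges G)"
  shows "vertex_degree G v = mset_degree (edge_mset G) v"
proof -
  have "size {#e \<in># edge_mset G. P e#} = card {e \<in> edges G. P (ends G e)}" for P
    using assms by (simp add: edge_mset_def filter_mset_image_mset)
  moreover have "count (edge_mset G) (Upair v v) = size {#e \<in># edge_mset G. e = Upair v v#}"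
    by (simp add: filter_eq_replicate_mset)
  ultimately show ?thesis
    by (simp add: vertex_degree_def mset_degree_def edges_between_def)
qed

lemma count_edge_image:
  assumes "finite (edges G)"
  shows "count (image_mset g (edge_mset G)) x = card {e \<in> edges G. g (ends G e) = x}"
proof -
  have "count (image_mset g (edge_mset G)) x = size {#y \<in># image_mset g (edge_mset G). y = x#}"
    by (simp add: filter_eq_replicate_mset)
  also have "\<dots> = card {e \<in> edges G. g (ends G e) = x}"
    using assms by (simp add: edge_mset_def filter_mset_image_mset)
  finally show ?thesis .
qed

lemma set_edge_mset:
  "finite (edges G) \<Longrightarrow> set_mset (edge_mset G) = ends G ` edges G"
  by (simp add: edge_mset_def)

lemma edge_mset_connected:
  assumes "finite (edges G)"
  shows "connected_graph G \<longleftrightarrow> mset_connected (verts G) (edge_mset G)"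
proof -
  have "adjacency G = {(a, b). Upair a b \<in># edge_mset G}"
    using assms by (force simp: adjacency_def edges_between_def set_edge_mset)
  then show ?thesis by (simp add: connected_graph_def mset_connected_def)
qed

lemma is_graph_iff:
  "is_graph G \<longleftrightarrow> finite (verts G) \<and> finite (edges G) \<and> card (verts G) \<ge> 2 \<and>
     (\<forall>e\<in>#edge_mset G. set_uprod e \<subseteq> verts G) \<and> mset_connected (verts G) (edge_mset G)"
proof (cases "finite (edges G)")
  case True
  then have "(\<forall>e\<in>#edge_mset G. set_uprod e \<subseteq> verts G) \<longleftrightarrow> (\<forall>e\<in>edges G. set_uprod (ends G e) \<subseteq> verts G)"
    by (simp add: set_edge_mset)
  then show ?thesis
    unfolding is_graph_def edge_mset_connected[OF True] by blast
qed (simp add: is_graph_def)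

text \<open>The definition compares multiplicities only for pairs inside \<open>verts G\<close>. Any
  other pair has multiplicity 0 on both sides, since edges of \<open>G\<close> and images of edges
  of \<open>H\<close> have their ends in \<open>verts G\<close>.\<close>

lemma hom_image_by_iff:
  assumes G: "is_graph G" and H: "is_graph H"
  shows "hom_image_by G H \<phi> \<longleftrightarrow>
    \<phi> ` verts H = verts G \<and> image_mset (map_uprod \<phi>) (edge_mset H) = edge_mset G"
proof -
  have fin: "finite (edges G)" "finite (edges H)"
    using G H by (auto simp: is_graph_def)
  have cG: "card (edges_between G u v) = count (edge_mset G) (Upair u v)" for u v
    using count_edge_image[OF fin(1), of id "Upair u v"]
    by (simp add: edges_between_def)
  have cH: "card {f \<in> edges H. map_uprod \<phi> (ends H f) = Upair u v}
      = count (image_mset (map_uprod \<phi>) (edge_mset H)) (Upair u v)" for u v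
    using count_edge_image[OF fin(2), of "map_uprod \<phi>"] by simp
  have "image_mset (map_uprod \<phi>) (edge_mset H) = edge_mset G"
    if onto: "\<phi> ` verts H = verts G"
      and eq: "\<forall>u\<in>verts G. \<forall>v\<in>verts G. count (edge_mset G) (Upair u v)
        = count (image_mset (map_uprod \<phi>) (edge_mset H)) (Upair u v)"
  proof (rule multiset_eqI)
    fix x
    show "count (image_mset (map_uprod \<phi>) (edge_mset H)) x = count (edge_mset G) x"
    proof (cases "set_uprod x \<subseteq> verts G")
      case True
      then show ?thesis using eq by (cases x) auto
    next
      case False
      then have "x \<notin># edge_mset G" using G by (auto simp: is_graph_iff)
      moreover have "x \<notin># image_mset (map_uprod \<phi>) (edge_mset H)"
      proof
        assume "x \<in># image_mset (map_uprod \<phi>) (edge_mset H)"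
        then obtain e where e: "e \<in># edge_mset H" "x = map_uprod \<phi> e" by auto
        then have "set_uprod e \<subseteq> verts H" using H by (auto simp: is_graph_iff)
        then show False using False e onto by (auto simp: uprod.set_map)
      qed
      ultimately show ?thesis by (simp only: not_in_iff)
    qed
  qed
  then show ?thesis
    unfolding hom_image_by_def cG cH by auto
qed

lemma k_trail_iff:
  "k_trail k G \<longleftrightarrow> is_graph G \<and> trail_image k (verts G) (edge_mset G)"
proof (cases "is_graph G")
  case G: True
  show ?thesis
  proof
    assume "k_trail k G"
    then obtain H :: "(nat, nat) multigraph" and \<phi>
      where H: "is_graph H" "\<forall>w\<in>verts H. vertex_degree H w \<le> k" "hom_image_by G H \<phi>"
      by (auto simp: k_trail_def)
    then have "\<forall>w\<in>verts H. mset_degree (edge_mset H) w \<le> k"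
      by (auto simp: is_graph_def edge_mset_degree)
    with H G show "is_graph G \<and> trail_image k (verts G) (edge_mset G)"
      unfolding trail_image_def is_graph_iff[of H] hom_image_by_iff[OF G H(1)] by blast
  next
    assume "is_graph G \<and> trail_image k (verts G) (edge_mset G)"
    then obtain W :: "nat set" and F \<phi> where W: "finite W" "card W \<ge> 2" "\<forall>e\<in>#F. set_uprod e \<subseteq> W"
      "mset_connected W F" "\<forall>w\<in>W. mset_degree F w \<le> k" "\<phi> ` W = verts G"
      "image_mset (map_uprod \<phi>) F = edge_mset G"
      by (auto simp: trail_image_def)
    \<comment> \<open>Listing \<open>F\<close> names its edges: the positions in the list serve as
      the edges of \<open>H\<close>.\<close>
    obtain xs where xs: "mset xs = F" using ex_mset by blast
    define H :: "(nat, nat) multigraph" where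
      "H = \<lparr>verts = W, edges = {..<length xs}, ends = nth xs\<rparr>"
    have F: "edge_mset H = F"
    proof -
      have "edge_mset H = mset (map (nth xs) [0..<length xs])"
        by (simp add: edge_mset_def H_def atLeast0LessThan flip: mset_set_upto_eq_mset_upto)
      then show ?thesis by (simp add: map_nth xs)
    qed
    have vH: "verts H = W" and fin: "finite (edges H)" by (simp_all add: H_def)
    have H: "is_graph H" using W fin by (simp add: is_graph_iff F vH)
    moreover have "hom_image_by G H \<phi>"
      using W by (simp add: hom_image_by_iff[OF G H] F vH)
    ultimately show "k_trail k G"
      using G W fin by (auto simp: k_trail_def edge_mset_degree F vH)
  qed
qed (simp add: k_trail_def)

section \<open>Subdividing an edge and adding a loop\<close>

lemma trail_image_subdivide:
  assumes "trail_image d V (add_mset (Upair u x) M)" and v: "v \<in> V" and d: "d \<ge> 2"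
  shows "trail_image d V (add_mset (Upair u v) (add_mset (Upair v x) M))"
proof -
  obtain W :: "nat set" and F \<phi> where W: "finite W" "card W \<ge> 2" "\<forall>e\<in>#F. set_uprod e \<subseteq> W"
    "mset_connected W F" "\<forall>w\<in>W. mset_degree F w \<le> d" "\<phi> ` W = V"
    "image_mset (map_uprod \<phi>) F = add_mset (Upair u x) M"
    using assms(1) by (auto simp: trail_image_def)
  obtain e F0 where F0: "F = add_mset e F0" "map_uprod \<phi> e = Upair u x"
    "image_mset (map_uprod \<phi>) F0 = M"
    using msed_map_invR[OF W(7)] by blast
  then obtain p q where pq: "e = Upair p q" "\<phi> p = u" "\<phi> q = x"
    by (cases e) (auto simp: Upair_inject)
  obtain n where n: "n \<notin> W" using W(1) ex_new_if_finite infinite_UNIV_nat by blast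
  \<comment> \<open>The edge \<open>pq\<close> over \<open>ux\<close> becomes a path through the
    fresh copy \<open>n\<close> of \<open>v\<close>. Degrees in \<open>W\<close> do not change, even
    if \<open>p = q\<close>, and \<open>n\<close> gets degree 2, which is where
    \<open>d \<ge> 2\<close> enters.\<close>
  define F' where "F' = add_mset (Upair p n) (add_mset (Upair n q) F0)"
  have pqW: "p \<in> W" "q \<in> W" using W(3) F0 pq by auto
  have F0W: "\<forall>e\<in>#F0. set_uprod e \<subseteq> W" using W(3) F0 by auto
  let ?R = "{(a, b). Upair a b \<in># F'}"
  have pn: "(p, n) \<in> ?R" "(n, p) \<in> ?R" "(n, q) \<in> ?R" "(q, n) \<in> ?R"
    by (auto simp: F'_def Upair_inject)
  \<comment> \<open>The only adjacency that may be lost, \<open>pq\<close>, is replaced by a walk of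
    two steps through \<open>n\<close>.\<close>
  have sub: "{(a, b). Upair a b \<in># F} \<subseteq> ?R\<^sup>*"
  proof clarify
    fix a b assume "Upair a b \<in># F"
    then consider "Upair a b \<in># F0" | "a = p" "b = q" | "a = q" "b = p"
      by (auto simp: F0 pq Upair_inject)
    then show "(a, b) \<in> ?R\<^sup>*"
    proof cases
      case 1
      then show ?thesis by (auto simp: F'_def)
    qed (use pn in \<open>meson converse_rtrancl_into_rtrancl r_into_rtrancl\<close>)+
  qed
  have WW: "(a, b) \<in> ?R\<^sup>*" if "a \<in> W" "b \<in> W" for a b
    using W(4) that rtrancl_subset_rtrancl[OF sub] by (auto simp: mset_connected_def)
  have "mset_connected (insert n W) F'"
    unfolding mset_connected_def using WW pqW pn
    by (metis (no_types, lifting) converse_rtrancl_into_rtrancl insert_iff rtrancl.simps)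
  moreover have "mset_degree F' w \<le> d" if "w \<in> insert n W" for w
  proof (cases "w = n")
    case True
    have "mset_degree F0 n = 0"
    proof (rule ccontr)
      assume "mset_degree F0 n \<noteq> 0"
      then obtain a M' where "F0 = add_mset (Upair n a) M'"
        using mset_degree_pos[of F0 n] by auto
      then show False using F0W n by auto
    qed
    then show ?thesis using True n pqW d by (auto simp: F'_def)
  next
    case False
    then have "mset_degree F' w = mset_degree F w" by (simp add: F'_def F0 pq)
    then show ?thesis using W(5) that False by auto
  qed
  moreover have "\<forall>e\<in>#F'. set_uprod e \<subseteq> insert n W"
    using F0W pqW by (auto simp: F'_def)
  moreover have "(\<phi>(n := v)) ` insert n W = V"
    using n W(6) v by auto
  moreover have "image_mset (map_uprod (\<phi>(n := v))) F'
      = add_mset (Upair u v) (add_mset (Upair v x) M)"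
  proof -
    \<comment> \<open>No edge of \<open>F0\<close> meets the fresh \<open>n\<close>, so the new
      value at \<open>n\<close> does not affect its image.\<close>
    have "map_uprod (\<phi>(n := v)) e = map_uprod \<phi> e" if "e \<in># F0" for e
      using F0W that n by (intro uprod.map_cong0) auto
    then have "image_mset (map_uprod (\<phi>(n := v))) F0 = M"
      using F0(3) by (metis (mono_tags, lifting) image_mset_cong)
    then show ?thesis using n pqW pq by (auto simp: F'_def)
  qed
  moreover have "finite (insert n W)" "card (insert n W) \<ge> 2" using W n by auto
  ultimately show ?thesis unfolding trail_image_def by blast
qed

text \<open>As \<open>W\<close> is connected with at least two vertices, a copy of \<open>v\<close>
  has a walk to another vertex; the first step of this walk is an edge.\<close>

lemma trail_image_obtain_edge:
  assumes "trail_image d V M" and "v \<in> V"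
  obtains a M' where "M = add_mset (Upair v a) M'"
proof -
  obtain W :: "nat set" and F \<phi> where W: "finite W" "card W \<ge> 2"
    "mset_connected W F" "\<phi> ` W = V" "image_mset (map_uprod \<phi>) F = M"
    using assms(1) by (auto simp: trail_image_def)
  obtain w where w: "w \<in> W" "\<phi> w = v" using W assms(2) by auto
  have "\<not> W \<subseteq> {w}" using W(2) card_mono[of "{w}" W] by auto
  then obtain w' where "w' \<in> W" "w' \<noteq> w" by auto
  then have "(w, w') \<in> {(a, b). Upair a b \<in># F}\<^sup>*" "w \<noteq> w'"
    using W(3) w by (auto simp: mset_connected_def)
  then obtain y where "Upair w y \<in># F"
    by (auto elim: converse_rtranclE)
  then have "Upair v (\<phi> y) \<in># M" using W(5) w by force
  then show thesis by (metis that multi_member_split)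
qed

text \<open>Subdividing \<open>va\<close> by a copy of \<open>v\<close> yields \<open>vv\<close> and
  \<open>va\<close>, so the old edge survives as one half.\<close>

lemma trail_image_add_loop:
  assumes "trail_image d V M" and "v \<in> V" and "d \<ge> 2"
  shows "trail_image d V (add_mset (Upair v v) M)"
proof -
  obtain a M' where "M = add_mset (Upair v a) M'"
    using trail_image_obtain_edge assms by metis
  then show ?thesis using trail_image_subdivide[of d V v a M' v] assms by simp
qed

section \<open>Adding the missing edges\<close>

lemma trail_image_add_matching:
  assumes "trail_image k V M" and D: "\<forall>e\<in>#D. set_uprod e \<subseteq> V"
    and deg: "\<And>v. mset_degree D v \<le> 1"
  shows "trail_image (k + 1) V (M + D)"
proof -
  obtain W :: "nat set" and F \<phi> where W: "finite W" "card W \<ge> 2" "\<forall>e\<in>#F. set_uprod e \<subseteq> W"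
    "mset_connected W F" "\<forall>w\<in>W. mset_degree F w \<le> k" "\<phi> ` W = V"
    "image_mset (map_uprod \<phi>) F = M"
    using assms(1) by (auto simp: trail_image_def)
  \<comment> \<open>One copy of each vertex is fixed, and \<open>D\<close> is lifted to these
    copies.\<close>
  define s where "s = inv_into W \<phi>"
  have s: "s v \<in> W" "\<phi> (s v) = v" if "v \<in> V" for v
    using that W(6) by (auto simp: s_def inv_into_into f_inv_into_f)
  define D' where "D' = image_mset (map_uprod s) D"
  have "map_uprod \<phi> (map_uprod s e) = e" if "e \<in># D" for e
    using D that s by (cases e) auto
  then have D': "image_mset (map_uprod \<phi>) D' = D"
    by (simp add: D'_def multiset.map_comp comp_def multiset.map_ident_strong)
  have "mset_degree (F + D') w \<le> k + 1" if "w \<in> W" for w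
  proof -
    \<comment> \<open>Mapping \<open>D'\<close> back gives \<open>D\<close>, and this cannot lower
      the degree.\<close>
    have "mset_degree D' w \<le> 1"
      using mset_degree_le_image[of D' w \<phi>] deg[of "\<phi> w"] by (simp add: D')
    then show ?thesis using W(5) that by fastforce
  qed
  moreover have "\<forall>e\<in>#F + D'. set_uprod e \<subseteq> W"
    using W(3) D s by (fastforce simp: D'_def uprod.set_map)
  moreover have "mset_connected W (F + D')"
  proof -
    have "{(a, b). Upair a b \<in># F} \<subseteq> {(a, b). Upair a b \<in># F + D'}" by auto
    then show ?thesis using W(4) rtrancl_mono unfolding mset_connected_def by blast
  qed
  moreover have "image_mset (map_uprod \<phi>) (F + D') = M + D" using D' W(7) by simp
  ultimately show ?thesis using W(1,2,6) unfolding trail_image_def by blast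
qed

text \<open>\<open>M\<close> stays fixed in the induction, so a matching is always attached to an
  image of degree at most \<open>k\<close>. Subdivisions come afterwards and respect
  \<open>k + 1\<close>, which is at least 2 as \<open>k > 0\<close>.\<close>

lemma trail_image_add_edges:
  assumes M: "trail_image k V M" and k: "k > 0" and "\<forall>e\<in>#D. set_uprod e \<subseteq> V"
  shows "trail_image (k + 1) V (M + D)"
  using assms(3)
proof (induction "size D" arbitrary: D rule: less_induct)
  case less
  show ?case
  proof (cases "\<forall>v. mset_degree D v \<le> 1")
    case True
    then show ?thesis using trail_image_add_matching M less.prems by blast
  next
    case False
    then obtain v where v: "mset_degree D v \<ge> 2" by (auto simp: not_le Suc_le_eq numeral_2_eq_2)
    then obtain a D1 where D1: "D = add_mset (Upair v a) D1"
      using mset_degree_pos[of D v] by auto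
    have vV: "v \<in> V" using less.prems D1 by auto
    show ?thesis
    proof (cases "a = v")
      case True
      have "trail_image (k + 1) V (M + D1)" using less D1 by auto
      then show ?thesis using trail_image_add_loop[OF _ vV] k D1 True by simp
    next
      case False
      \<comment> \<open>As \<open>a\<close> differs from \<open>v\<close>, the edge
        \<open>va\<close> uses only one of the at least two ends at \<open>v\<close>.\<close>
      then have "mset_degree D1 v > 0" using v D1 by simp
      then obtain b D2 where D2: "D1 = add_mset (Upair v b) D2"
        using mset_degree_pos by metis
      \<comment> \<open>Two edges have become one, so the size drops. The cases
        \<open>b = a\<close>, where \<open>ab\<close> is a loop, and \<open>b = v\<close> are
        included.\<close>
      have "trail_image (k + 1) V (M + add_mset (Upair a b) D2)"
        using D1 D2 less.prems by (intro less.hyps) auto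
      then have "trail_image (k + 1) V (add_mset (Upair a v) (add_mset (Upair v b) (M + D2)))"
        using trail_image_subdivide[OF _ vV] k by simp
      moreover have "Upair a v = Upair v a" by (simp add: Upair_inject)
      ultimately show ?thesis using D1 D2 by simp
    qed
  qed
qed

theorem theorem3:
  fixes G :: "('v, 'e) multigraph" and k :: nat
  assumes "k > 0" and "is_graph G" and "contains_k_trail k G"
  shows "k_trail (k + 1) G"
proof -
  obtain U where U: "U \<subseteq> edges G" "k_trail k (G\<lparr>edges := U\<rparr>)"
    using assms(3) by (auto simp: contains_k_trail_def)
  define D where "D = image_mset (ends G) (mset_set (edges G - U))"
  have fin: "finite (edges G)" using assms(2) by (simp add: is_graph_def)
  have "mset_set (edges G) = mset_set U + mset_set (edges G - U)"
    using fin U(1) by (metis mset_set_Union Diff_disjoint Diff_partition finite_Diff finite_subset)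
  then have "edge_mset G = edge_mset (G\<lparr>edges := U\<rparr>) + D"
    by (simp add: edge_mset_def D_def)
  moreover have "trail_image k (verts G) (edge_mset (G\<lparr>edges := U\<rparr>))"
    using U(2) by (simp add: k_trail_iff)
  moreover have "\<forall>e\<in>#D. set_uprod e \<subseteq> verts G"
    using assms(2) fin by (auto simp: D_def is_graph_def)
  ultimately show ?thesis
    using trail_image_add_edges[of k "verts G"] assms(1,2) by (simp add: k_trail_iff)
qed

end
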